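(* Let $\mathcal{D}:\mathcal{C}^1(I)\to\mathcal{C}^1_{\mathbb{C}}(I)$ be an operator satisfying: (i) (gluing) for every deterministic differentiable process $X$ (of class $C^1$), $\mathcal{D}X(t)=dX/dt$; (ii) $\mathcal{D}$ is $\mathbb{R}$-linear; (iii) (reconstruction) $\mathcal{D}X=A(DX,D_*X)+iB(DX,D_*X)$, where $A$ and $B$ are linear $\mathbb{R}$-valued mappings (fixed real linear combinations of $DX$ and $D_*X$), and the mapping $(DX,D_*X)\mapsto(A(DX,D_*X),B(DX,D_*X))$ is invertible; (iv) if $D_*=-D$, then $A=0$ and $B=D$. Then $\mathcal{D}$ is of the form $$\mathcal{D}_\mu=\frac{D+D_*}{2}+i\mu\frac{D-D_*}{2},\qquad \mu=\pm1 .$$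
   Context: $(\Omega,\mathcal{A},P)$ is a probability space and $I$ an open interval, with an increasing family $(\mathcal{P}_t)$ and a decreasing family $(\mathcal{F}_t)$ of sub-$\sigma$-algebras; processes are both $\mathcal{P}_t$- and $\mathcal{F}_t$-adapted. Nelson derivatives (limits in $L^1(\Omega)$): $DX(t)=\lim_{h\to0^+}E[\frac{X(t+h)-X(t)}{h}\mid\mathcal{P}_t]$, $D_*X(t)=\lim_{h\to0^+}E[\frac{X(t)-X(t-h)}{h}\mid\mathcal{F}_t]$. $\mathcal{C}^1(I)$ is the set (completed in the norm $\sup_t(\|X\|_{L^2}+\|DX\|_{L^2}+\|D_*X\|_{L^2})$) of real processes with continuous paths such that $X(t),DX(t),D_*X(t)$ exist, lie in $L^2(\Omega)$ and are continuous in $t$ in $L^2(\Omega)$, and such that $\lim_{h\to 0^+}E[(X(t+h)-X(t))^2/h\mid\mathcal{P}_t]$ and $\lim_{h\to0^+}E[(X(t+h)-X(t))^2/h\mid\mathcal{F}_t]$ exist in $L^1(\Omega)$. $\mathcal{C}^1_{\mathbb{C}}(I)=\{X+iY:X,Y\in\mathcal{C}^1(I)\}$. A deterministic process is one with $X(\omega)=f$ for all $\omega$, for a fixed function $f$; for $f\in C^1$, $DX=D_*X=f'$. *)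

theory Defs
  imports "HOL-Probability.Probability"
begin

(* A process on I is a function X :: real => 'a => real of which only the values X t, t in I,
   matter.  Random variables are functions on the space of M; identities between L^1 or L^2
   elements are stated almost everywhere, separately for each t in I. *)

locale nelson_setting = prob_space M
  for M :: "'a measure" +
  fixes I :: "real set"
    and P F :: "real \<Rightarrow> 'a measure"
  assumes open_I: "open I"
    and interval_I: "is_interval I"
    and subalgebra_P: "\<And>t. t \<in> I \<Longrightarrow> subalgebra M (P t)"
    and subalgebra_F: "\<And>t. t \<in> I \<Longrightarrow> subalgebra M (F t)"
    and increasing_P: "\<And>s t. \<lbrakk>s \<in> I; t \<in> I; s \<le> t\<rbrakk> \<Longrightarrow> sets (P s) \<subseteq> sets (P t)"
    and decreasing_F: "\<And>s t. \<lbrakk>s \<in> I; t \<in> I; s \<le> t\<rbrakk> \<Longrightarrow> sets (F t) \<subseteq> sets (F s)"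

definition adapted :: "real set \<Rightarrow> (real \<Rightarrow> 'a measure) \<Rightarrow> (real \<Rightarrow> 'a \<Rightarrow> real) \<Rightarrow> bool" where
  "adapted I G X \<longleftrightarrow> (\<forall>t\<in>I. X t \<in> borel_measurable (G t))"

definition in_L2 :: "'a measure \<Rightarrow> ('a \<Rightarrow> real) \<Rightarrow> bool" where
  "in_L2 M f \<longleftrightarrow> f \<in> borel_measurable M \<and> integrable M (\<lambda>\<omega>. (f \<omega>)\<^sup>2)"

(* Only meaningful for f in L^2, since non-integrable functions have integral 0. *)
definition L2_norm :: "'a measure \<Rightarrow> ('a \<Rightarrow> real) \<Rightarrow> real" where
  "L2_norm M f = sqrt (\<integral>\<omega>. (f \<omega>)\<^sup>2 \<partial>M)"

definition L2_continuous_on :: "'a measure \<Rightarrow> real set \<Rightarrow> (real \<Rightarrow> 'a \<Rightarrow> real) \<Rightarrow> bool" where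
  "L2_continuous_on M I X \<longleftrightarrow>
     (\<forall>t\<in>I. ((\<lambda>s. L2_norm M (\<lambda>\<omega>. X s \<omega> - X t \<omega>)) \<longlongrightarrow> 0) (at t within I))"

definition L1_limit_at_0 :: "'a measure \<Rightarrow> (real \<Rightarrow> 'a \<Rightarrow> real) \<Rightarrow> ('a \<Rightarrow> real) \<Rightarrow> bool" where
  "L1_limit_at_0 M q Y \<longleftrightarrow>
     integrable M Y \<and> (\<forall>\<^sub>F h in at_right 0. integrable M (q h)) \<and>
     ((\<lambda>h. \<integral>\<omega>. \<bar>q h \<omega> - Y \<omega>\<bar> \<partial>M) \<longlongrightarrow> 0) (at_right 0)"

definition has_forward_derivative ::
    "'a measure \<Rightarrow> (real \<Rightarrow> 'a measure) \<Rightarrow> (real \<Rightarrow> 'a \<Rightarrow> real) \<Rightarrow> real \<Rightarrow> ('a \<Rightarrow> real) \<Rightarrow> bool" where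
  "has_forward_derivative M P X t Y \<longleftrightarrow>
     L1_limit_at_0 M (\<lambda>h. real_cond_exp M (P t) (\<lambda>\<omega>. (X (t + h) \<omega> - X t \<omega>) / h)) Y"

definition has_backward_derivative ::
    "'a measure \<Rightarrow> (real \<Rightarrow> 'a measure) \<Rightarrow> (real \<Rightarrow> 'a \<Rightarrow> real) \<Rightarrow> real \<Rightarrow> ('a \<Rightarrow> real) \<Rightarrow> bool" where
  "has_backward_derivative M F X t Y \<longleftrightarrow>
     L1_limit_at_0 M (\<lambda>h. real_cond_exp M (F t) (\<lambda>\<omega>. (X t \<omega> - X (t - h) \<omega>) / h)) Y"

(* The L^1 limits are unique up to null sets; the choice operator picks a representative. *)
definition forward_derivative ::
    "'a measure \<Rightarrow> (real \<Rightarrow> 'a measure) \<Rightarrow> (real \<Rightarrow> 'a \<Rightarrow> real) \<Rightarrow> real \<Rightarrow> 'a \<Rightarrow> real" where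
  "forward_derivative M P X t = (SOME Y. has_forward_derivative M P X t Y)"

definition backward_derivative ::
    "'a measure \<Rightarrow> (real \<Rightarrow> 'a measure) \<Rightarrow> (real \<Rightarrow> 'a \<Rightarrow> real) \<Rightarrow> real \<Rightarrow> 'a \<Rightarrow> real" where
  "backward_derivative M F X t = (SOME Y. has_backward_derivative M F X t Y)"

definition nelson_differentiable ::
    "'a measure \<Rightarrow> real set \<Rightarrow> (real \<Rightarrow> 'a measure) \<Rightarrow> (real \<Rightarrow> 'a measure) \<Rightarrow>
     (real \<Rightarrow> 'a \<Rightarrow> real) \<Rightarrow> bool" where
  "nelson_differentiable M I P F X \<longleftrightarrow>
     adapted I P X \<and> adapted I F X \<and>
     (\<forall>t\<in>I. in_L2 M (X t) \<and>
        (\<exists>Y. has_forward_derivative M P X t Y) \<and> in_L2 M (forward_derivative M P X t) \<and>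
        (\<exists>Y. has_backward_derivative M F X t Y) \<and> in_L2 M (backward_derivative M F X t))"

(* The class of processes before completion.  The parameter s is meant to be 1 or -1: for s = 1 the second
   quadratic limit is that of E[(X(t+h) - X(t))^2 / h | F_t], while for s = -1 it is Nelson's
   backward quadratic limit, that of E[(X(t) - X(t-h))^2 / h | F_t]. *)
definition C1_pre ::
    "'a measure \<Rightarrow> real set \<Rightarrow> (real \<Rightarrow> 'a measure) \<Rightarrow> (real \<Rightarrow> 'a measure) \<Rightarrow> real \<Rightarrow>
     (real \<Rightarrow> 'a \<Rightarrow> real) set" where
  "C1_pre M I P F s = {X.
     nelson_differentiable M I P F X \<and>
     (\<forall>\<omega>\<in>space M. continuous_on I (\<lambda>t. X t \<omega>)) \<and>
     L2_continuous_on M I X \<and>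
     L2_continuous_on M I (forward_derivative M P X) \<and>
     L2_continuous_on M I (backward_derivative M F X) \<and>
     (\<forall>t\<in>I. \<exists>Q. L1_limit_at_0 M
        (\<lambda>h. real_cond_exp M (P t) (\<lambda>\<omega>. (X (t + h) \<omega> - X t \<omega>)\<^sup>2 / h)) Q) \<and>
     (\<forall>t\<in>I. \<exists>Q. L1_limit_at_0 M
        (\<lambda>h. real_cond_exp M (F t) (\<lambda>\<omega>. (X (t + s * h) \<omega> - X t \<omega>)\<^sup>2 / h)) Q)}"

(* Extended-valued, because processes in the class may be unbounded on the open interval I. *)
definition C1_norm ::
    "'a measure \<Rightarrow> real set \<Rightarrow> (real \<Rightarrow> 'a measure) \<Rightarrow> (real \<Rightarrow> 'a measure) \<Rightarrow>
     (real \<Rightarrow> 'a \<Rightarrow> real) \<Rightarrow> ennreal" where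
  "C1_norm M I P F X =
     (SUP t\<in>I. ennreal (L2_norm M (X t) + L2_norm M (forward_derivative M P X t)
                         + L2_norm M (backward_derivative M F X t)))"

(* The completion, realised as a closure inside the Nelson differentiable processes.  Every
   Cauchy sequence for the norm has such a limit: writing E[X(t+h) - X(t) | P_t] as the integral
   of E[DX(r) | P_t] over r in [t, t+h], and similarly backwards, shows that D and D_* are
   closed under L^2 convergence that is uniform in t. *)
definition C1 ::
    "'a measure \<Rightarrow> real set \<Rightarrow> (real \<Rightarrow> 'a measure) \<Rightarrow> (real \<Rightarrow> 'a measure) \<Rightarrow> real \<Rightarrow>
     (real \<Rightarrow> 'a \<Rightarrow> real) set" where
  "C1 M I P F s = {X.
     nelson_differentiable M I P F X \<and>
     (\<exists>Z :: nat \<Rightarrow> real \<Rightarrow> 'a \<Rightarrow> real. (\<forall>n. Z n \<in> C1_pre M I P F s) \<and>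
        (\<lambda>n. C1_norm M I P F (\<lambda>t \<omega>. Z n t \<omega> - X t \<omega>)) \<longlonglongrightarrow> 0)}"

definition deterministic ::
    "'a measure \<Rightarrow> real set \<Rightarrow> (real \<Rightarrow> 'a \<Rightarrow> real) \<Rightarrow> (real \<Rightarrow> real) \<Rightarrow> bool" where
  "deterministic M I X f \<longleftrightarrow> (\<forall>t\<in>I. \<forall>\<omega>\<in>space M. X t \<omega> = f t)"

end

theory Submission
  imports Defs
begin

text \<open>
  Since \<open>A\<close> and \<open>B\<close> are linear on the plane, they are determined by their values on the basis
  \<open>(1, 1)\<close>, \<open>(1, - 1)\<close>.  The values at \<open>(1, - 1)\<close> are prescribed by the hypothesis on processes with
  \<open>D\<^sub>* = - D\<close>.  The values at \<open>(1, 1)\<close> come from one test process, the clock \<open>X t \<omega> = t\<close>: it lies in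
  the class and has \<open>D X = D\<^sub>* X = 1\<close>, while gluing gives \<open>\<D> X = 1\<close>, so the reconstruction formula reads
  \<open>1 = A (1, 1) + \<i> B (1, 1)\<close>, an identity between constants that holds almost surely and hence holds.
  Therefore \<open>A (x, y) = (x + y) / 2\<close> and \<open>B (x, y) = (x - y) / 2\<close>, which is the asserted form with
  \<open>\<mu> = 1\<close>; the other sign corresponds to the convention \<open>B = - D\<close> for \<open>D\<^sub>* = - D\<close>.

  The analytic work is to verify that the clock is in the class.  This is done for every deterministic
  process of class \<open>C\<^sup>1\<close> (\<open>deterministic_in_C1\<close>): a conditional expectation of a constant is that
  constant, so the Nelson derivatives and the quadratic limits of such a process are limits of
  ordinary difference quotients.
\<close>

section \<open>Limits in \<open>L\<^sup>1\<close> and almost surely constant random variables\<close>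

context prob_space
begin

text \<open>
  Nelson derivatives are defined through an arbitrary choice of limit; this lemma makes the choice
  immaterial up to null sets.
\<close>
lemma L1_limit_at_0_unique:
  assumes "L1_limit_at_0 M q Y" "L1_limit_at_0 M q Z"
  shows "AE \<omega> in M. Y \<omega> = Z \<omega>"
proof -
  have Y: "integrable M Y" and Z: "integrable M Z"
    and q: "\<forall>\<^sub>F h in at_right 0. integrable M (q h)"
    and limY: "((\<lambda>h. \<integral>\<omega>. \<bar>q h \<omega> - Y \<omega>\<bar> \<partial>M) \<longlongrightarrow> 0) (at_right 0)"
    and limZ: "((\<lambda>h. \<integral>\<omega>. \<bar>q h \<omega> - Z \<omega>\<bar> \<partial>M) \<longlongrightarrow> 0) (at_right 0)"
    using assms by (auto simp: L1_limit_at_0_def)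
  have "\<forall>\<^sub>F h in at_right 0. (\<integral>\<omega>. \<bar>Y \<omega> - Z \<omega>\<bar> \<partial>M)
          \<le> (\<integral>\<omega>. \<bar>q h \<omega> - Y \<omega>\<bar> \<partial>M) + (\<integral>\<omega>. \<bar>q h \<omega> - Z \<omega>\<bar> \<partial>M)"
    using q
  proof eventually_elim
    case (elim h)
    have "(\<integral>\<omega>. \<bar>Y \<omega> - Z \<omega>\<bar> \<partial>M) \<le> (\<integral>\<omega>. \<bar>q h \<omega> - Y \<omega>\<bar> + \<bar>q h \<omega> - Z \<omega>\<bar> \<partial>M)"
      by (rule integral_mono) (use Y Z elim in auto)
    also have "\<dots> = (\<integral>\<omega>. \<bar>q h \<omega> - Y \<omega>\<bar> \<partial>M) + (\<integral>\<omega>. \<bar>q h \<omega> - Z \<omega>\<bar> \<partial>M)"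
      by (rule Bochner_Integration.integral_add) (use Y Z elim in auto)
    finally show ?case .
  qed
  then have "(\<integral>\<omega>. \<bar>Y \<omega> - Z \<omega>\<bar> \<partial>M) \<le> 0 + 0"
    by (rule tendsto_lowerbound[OF tendsto_add[OF limY limZ]]) simp
  moreover have "0 \<le> (\<integral>\<omega>. \<bar>Y \<omega> - Z \<omega>\<bar> \<partial>M)"
    by simp
  ultimately have "(\<integral>\<omega>. \<bar>Y \<omega> - Z \<omega>\<bar> \<partial>M) = 0"
    by simp
  then have "AE \<omega> in M. \<bar>Y \<omega> - Z \<omega>\<bar> = 0"
    by (subst (asm) integral_nonneg_eq_0_iff_AE) (use Y Z in auto)
  then show ?thesis
    by simp
qed

lemma real_cond_exp_const:
  assumes "subalgebra M G"
  shows "AE \<omega> in M. real_cond_exp M G (\<lambda>_. c) \<omega> = c"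
proof -
  interpret finite_measure_subalgebra M G
    using assms by unfold_locales
  show ?thesis
    by (rule real_cond_exp_F_meas) auto
qed

text \<open>
  Conditioning does not change deterministic quotients, so their convergence in \<open>L\<^sup>1\<close> is convergence
  of real numbers.
\<close>
lemma L1_limit_at_0_const:
  assumes G: "subalgebra M G" and lim: "(c \<longlongrightarrow> l) (at_right 0)"
  shows "L1_limit_at_0 M (\<lambda>h. real_cond_exp M G (\<lambda>_. c h)) (\<lambda>_. l)"
proof -
  interpret finite_measure_subalgebra M G
    using G by unfold_locales
  have "(\<integral>\<omega>. \<bar>real_cond_exp M G (\<lambda>_. c h) \<omega> - l\<bar> \<partial>M) = \<bar>c h - l\<bar>" for h
  proof -
    have "(\<integral>\<omega>. \<bar>real_cond_exp M G (\<lambda>_. c h) \<omega> - l\<bar> \<partial>M) = (\<integral>\<omega>. \<bar>c h - l\<bar> \<partial>M)"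
    proof (rule integral_cong_AE)
      show "AE \<omega> in M. \<bar>real_cond_exp M G (\<lambda>_. c h) \<omega> - l\<bar> = \<bar>c h - l\<bar>"
        using real_cond_exp_const[OF G, of "c h"] by eventually_elim simp
    qed simp_all
    then show ?thesis
      by (simp add: prob_space)
  qed
  moreover have "((\<lambda>h. \<bar>c h - l\<bar>) \<longlongrightarrow> 0) (at_right 0)"
    using lim by (simp add: tendsto_rabs_zero_iff LIM_zero)
  ultimately show ?thesis
    unfolding L1_limit_at_0_def by (auto intro!: always_eventually real_cond_exp_int)
qed

lemma in_L2_AE_const:
  assumes "f \<in> borel_measurable M" "AE \<omega> in M. f \<omega> = c"
  shows "in_L2 M f"
proof -
  have "integrable M (\<lambda>\<omega>. (f \<omega>)\<^sup>2) \<longleftrightarrow> integrable M (\<lambda>\<omega>. c\<^sup>2)"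
    by (rule integrable_cong_AE) (use assms in auto)
  then show ?thesis
    using assms(1) by (simp add: in_L2_def)
qed

lemma L2_norm_AE_const:
  assumes "f \<in> borel_measurable M" "AE \<omega> in M. f \<omega> = c"
  shows "L2_norm M f = \<bar>c\<bar>"
proof -
  have "(\<integral>\<omega>. (f \<omega>)\<^sup>2 \<partial>M) = (\<integral>\<omega>. c\<^sup>2 \<partial>M)"
    by (rule integral_cong_AE) (use assms in auto)
  then show ?thesis
    by (simp add: L2_norm_def prob_space)
qed

lemma L2_continuous_on_AE_const:
  assumes meas: "\<And>t. t \<in> I \<Longrightarrow> X t \<in> borel_measurable M"
    and const: "\<And>t. t \<in> I \<Longrightarrow> AE \<omega> in M. X t \<omega> = f t"
    and cont: "continuous_on I f"
  shows "L2_continuous_on M I X"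
  unfolding L2_continuous_on_def
proof
  fix t assume t: "t \<in> I"
  have norm: "L2_norm M (\<lambda>\<omega>. X u \<omega> - X t \<omega>) = \<bar>f u - f t\<bar>" if "u \<in> I" for u
    by (rule L2_norm_AE_const) (use meas const[OF t] const[OF that] t that in auto)
  have "((\<lambda>u. \<bar>f u - f t\<bar>) \<longlongrightarrow> 0) (at t within I)"
    using cont t by (simp add: continuous_on_def tendsto_rabs_zero_iff LIM_zero)
  moreover have "\<forall>\<^sub>F u in at t within I. \<bar>f u - f t\<bar> = L2_norm M (\<lambda>\<omega>. X u \<omega> - X t \<omega>)"
    by (simp add: eventually_at_filter norm)
  ultimately show "((\<lambda>u. L2_norm M (\<lambda>\<omega>. X u \<omega> - X t \<omega>)) \<longlongrightarrow> 0) (at t within I)"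
    by (rule Lim_transform_eventually)
qed

section \<open>Nelson derivatives of deterministic processes\<close>

lemma deterministic_has_forward_derivative:
  assumes G: "subalgebra M (P t)" and der: "(f has_real_derivative f') (at t)"
  shows "has_forward_derivative M P (\<lambda>t _. f t) t (\<lambda>_. f')"
proof -
  have "((\<lambda>h. (f (t + h) - f t) / h) \<longlongrightarrow> f') (at_right 0)"
    using der by (auto simp: DERIV_def intro: filterlim_mono at_le)
  from L1_limit_at_0_const[OF G this] show ?thesis
    by (simp add: has_forward_derivative_def)
qed

lemma deterministic_has_backward_derivative:
  assumes G: "subalgebra M (F t)" and der: "(f has_real_derivative f') (at t)"
  shows "has_backward_derivative M F (\<lambda>t _. f t) t (\<lambda>_. f')"
proof -
  have "((\<lambda>h. (f (t + h) - f t) / h) \<longlongrightarrow> f') (at_left 0)"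
    using der by (auto simp: DERIV_def intro: filterlim_mono at_le)
  then have "((\<lambda>h. (f (t - h) - f t) / (- h)) \<longlongrightarrow> f') (at_right 0)"
    by (simp add: filterlim_at_left_to_right)
  moreover have "(f (t - h) - f t) / (- h) = (f t - f (t - h)) / h" for h
    by (simp add: minus_divide_left)
  ultimately have "((\<lambda>h. (f t - f (t - h)) / h) \<longlongrightarrow> f') (at_right 0)"
    by simp
  from L1_limit_at_0_const[OF G this] show ?thesis
    by (simp add: has_backward_derivative_def)
qed

lemma forward_derivative_deterministic:
  assumes "subalgebra M (P t)" "(f has_real_derivative f') (at t)"
  shows "forward_derivative M P (\<lambda>t _. f t) t \<in> borel_measurable M"
    and "AE \<omega> in M. forward_derivative M P (\<lambda>t _. f t) t \<omega> = f'"
proof -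
  have const: "has_forward_derivative M P (\<lambda>t _. f t) t (\<lambda>_. f')"
    using assms by (rule deterministic_has_forward_derivative)
  then have chosen: "has_forward_derivative M P (\<lambda>t _. f t) t (forward_derivative M P (\<lambda>t _. f t) t)"
    unfolding forward_derivative_def by (rule someI[of "has_forward_derivative M P (\<lambda>t _. f t) t"])
  then show "forward_derivative M P (\<lambda>t _. f t) t \<in> borel_measurable M"
    by (auto simp: has_forward_derivative_def L1_limit_at_0_def)
  show "AE \<omega> in M. forward_derivative M P (\<lambda>t _. f t) t \<omega> = f'"
    using chosen const unfolding has_forward_derivative_def by (rule L1_limit_at_0_unique)
qed

lemma backward_derivative_deterministic:
  assumes "subalgebra M (F t)" "(f has_real_derivative f') (at t)"
  shows "backward_derivative M F (\<lambda>t _. f t) t \<in> borel_measurable M"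
    and "AE \<omega> in M. backward_derivative M F (\<lambda>t _. f t) t \<omega> = f'"
proof -
  have const: "has_backward_derivative M F (\<lambda>t _. f t) t (\<lambda>_. f')"
    using assms by (rule deterministic_has_backward_derivative)
  then have chosen: "has_backward_derivative M F (\<lambda>t _. f t) t (backward_derivative M F (\<lambda>t _. f t) t)"
    unfolding backward_derivative_def by (rule someI[of "has_backward_derivative M F (\<lambda>t _. f t) t"])
  then show "backward_derivative M F (\<lambda>t _. f t) t \<in> borel_measurable M"
    by (auto simp: has_backward_derivative_def L1_limit_at_0_def)
  show "AE \<omega> in M. backward_derivative M F (\<lambda>t _. f t) t \<omega> = f'"
    using chosen const unfolding has_backward_derivative_def by (rule L1_limit_at_0_unique)
qed

end

text \<open>
  A differentiable function has no quadratic variation: the quotient below is \<open>h\<close> times the square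
  of a convergent difference quotient.  The parameter \<open>s\<close> lets one statement serve the increments to
  the right and to the left.
\<close>
lemma quadratic_quotient_tendsto_0:
  fixes f :: "real \<Rightarrow> real"
  assumes der: "(f has_real_derivative f') (at t)" and s: "s \<in> {1, -1}"
  shows "((\<lambda>h. (f (t + s * h) - f t)\<^sup>2 / h) \<longlongrightarrow> 0) (at_right 0)"
proof -
  have "((\<lambda>h. (f (t + h) - f t) / h) \<longlongrightarrow> f') (at 0)"
    using der by (simp add: DERIV_def)
  moreover have "filterlim (\<lambda>h. s * h) (at 0) (at_right (0::real))"
    using s by (auto simp: filterlim_at eventually_at_filter intro!: tendsto_eq_intros)
  ultimately have "((\<lambda>h. (f (t + s * h) - f t) / (s * h)) \<longlongrightarrow> f') (at_right 0)"
    by (rule filterlim_compose)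
  then have "((\<lambda>h. h * ((f (t + s * h) - f t) / (s * h))\<^sup>2) \<longlongrightarrow> 0 * f'\<^sup>2) (at_right 0)"
    by (intro tendsto_intros)
  moreover have "h * ((f (t + s * h) - f t) / (s * h))\<^sup>2 = (f (t + s * h) - f t)\<^sup>2 / h" for h
    using s by (cases "h = 0") (auto simp: power2_eq_square)
  ultimately show ?thesis
    by simp
qed

section \<open>Deterministic processes in the class\<close>

context nelson_setting
begin

lemma deterministic_nelson_differentiable:
  assumes der: "\<And>t. t \<in> I \<Longrightarrow> (f has_real_derivative f' t) (at t)"
  shows "nelson_differentiable M I P F (\<lambda>t _. f t)"
  unfolding nelson_differentiable_def
proof (intro conjI ballI)
  show "adapted I P (\<lambda>t _. f t)" "adapted I F (\<lambda>t _. f t)"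
    by (auto simp: adapted_def)
  fix t assume t: "t \<in> I"
  show "in_L2 M (\<lambda>_. f t)"
    by (rule in_L2_AE_const) auto
  show "\<exists>Y. has_forward_derivative M P (\<lambda>t _. f t) t Y"
    using deterministic_has_forward_derivative[of P t f, OF subalgebra_P[OF t] der[OF t]] by blast
  show "\<exists>Y. has_backward_derivative M F (\<lambda>t _. f t) t Y"
    using deterministic_has_backward_derivative[of F t f, OF subalgebra_F[OF t] der[OF t]] by blast
  show "in_L2 M (forward_derivative M P (\<lambda>t _. f t) t)"
    using forward_derivative_deterministic[of P t f, OF subalgebra_P[OF t] der[OF t]] by (rule in_L2_AE_const)
  show "in_L2 M (backward_derivative M F (\<lambda>t _. f t) t)"
    using backward_derivative_deterministic[of F t f, OF subalgebra_F[OF t] der[OF t]] by (rule in_L2_AE_const)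
qed

lemma deterministic_in_C1_pre:
  assumes der: "\<And>t. t \<in> I \<Longrightarrow> (f has_real_derivative f' t) (at t)"
    and cont': "continuous_on I f'" and s: "s \<in> {1, -1}"
  shows "(\<lambda>t _. f t) \<in> C1_pre M I P F s"
  unfolding C1_pre_def mem_Collect_eq
proof (intro conjI ballI)
  have cont: "continuous_on I f"
    by (auto intro!: continuous_at_imp_continuous_on DERIV_isCont der)
  show "nelson_differentiable M I P F (\<lambda>t _. f t)"
    using der by (rule deterministic_nelson_differentiable)
  show "continuous_on I (\<lambda>t. f t)" for \<omega> :: 'a
    by (rule cont)
  show "L2_continuous_on M I (\<lambda>t _. f t)"
    using cont by (intro L2_continuous_on_AE_const) auto
  show "L2_continuous_on M I (forward_derivative M P (\<lambda>t _. f t))"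
    using cont' by (intro L2_continuous_on_AE_const)
      (auto intro: forward_derivative_deterministic subalgebra_P der)
  show "L2_continuous_on M I (backward_derivative M F (\<lambda>t _. f t))"
    using cont' by (intro L2_continuous_on_AE_const)
      (auto intro: backward_derivative_deterministic subalgebra_F der)
  fix t assume t: "t \<in> I"
  have "((\<lambda>h. (f (t + h) - f t)\<^sup>2 / h) \<longlongrightarrow> 0) (at_right 0)"
    using quadratic_quotient_tendsto_0[OF der[OF t], of 1] by simp
  from L1_limit_at_0_const[OF subalgebra_P[OF t] this]
  show "\<exists>Q. L1_limit_at_0 M (\<lambda>h. real_cond_exp M (P t) (\<lambda>_. (f (t + h) - f t)\<^sup>2 / h)) Q"
    by blast
  from L1_limit_at_0_const[OF subalgebra_F[OF t] quadratic_quotient_tendsto_0[OF der[OF t] s]]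
  show "\<exists>Q. L1_limit_at_0 M (\<lambda>h. real_cond_exp M (F t) (\<lambda>_. (f (t + s * h) - f t)\<^sup>2 / h)) Q"
    by blast
qed

text \<open>
  The zero process may have non-zero representatives as derivatives, so that its norm vanishes rests
  on their being null almost everywhere.
\<close>
lemma C1_norm_zero: "C1_norm M I P F (\<lambda>t _. 0) = 0"
proof -
  have "L2_norm M (\<lambda>_. 0) + L2_norm M (forward_derivative M P (\<lambda>t _. 0) t)
          + L2_norm M (backward_derivative M F (\<lambda>t _. 0) t) = 0" if "t \<in> I" for t
  proof -
    have der: "((\<lambda>_. 0) has_real_derivative 0) (at t)"
      by simp
    show ?thesis
      using L2_norm_AE_const[OF forward_derivative_deterministic[of P t "\<lambda>_. 0", OF subalgebra_P[OF that] der]]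
        L2_norm_AE_const[OF backward_derivative_deterministic[of F t "\<lambda>_. 0", OF subalgebra_F[OF that] der]]
        L2_norm_AE_const[of "\<lambda>_. 0" 0]
      by simp
  qed
  then show ?thesis
    unfolding C1_norm_def by (cases "I = {}") (simp_all add: bot_ennreal)
qed

text \<open>The constant sequence shows that the process lies in the closure.\<close>
lemma deterministic_in_C1:
  assumes der: "\<And>t. t \<in> I \<Longrightarrow> (f has_real_derivative f' t) (at t)"
    and cont': "continuous_on I f'" and s: "s \<in> {1, -1}"
  shows "(\<lambda>t _. f t) \<in> C1 M I P F s"
  unfolding C1_def mem_Collect_eq
proof (intro conjI exI[of _ "\<lambda>n t _. f t"] allI)
  show "nelson_differentiable M I P F (\<lambda>t _. f t)"
    using der by (rule deterministic_nelson_differentiable)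
  show "(\<lambda>t _. f t) \<in> C1_pre M I P F s" for n :: nat
    using der cont' s by (rule deterministic_in_C1_pre)
  show "(\<lambda>n::nat. C1_norm M I P F (\<lambda>t \<omega>. f t - f t)) \<longlonglongrightarrow> 0"
    by (simp add: C1_norm_zero)
qed

end

section \<open>Determination of the operator\<close>

lemma linear_plane_decomposition:
  fixes L :: "real \<times> real \<Rightarrow> real"
  assumes "linear L"
  shows "L (x, y) = (x + y) / 2 * L (1, 1) + (x - y) / 2 * L (1, -1)"
proof -
  have "(x, y) = ((x + y) / 2) *\<^sub>R (1, 1) + ((x - y) / 2) *\<^sub>R (1, -1)"
    by (simp add: field_simps)
  then have "L (x, y) = L (((x + y) / 2) *\<^sub>R (1, 1) + ((x - y) / 2) *\<^sub>R (1, -1))"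
    by (rule arg_cong)
  also have "\<dots> = (x + y) / 2 * L (1, 1) + (x - y) / 2 * L (1, -1)"
    by (simp only: linear_add[OF assms] linear_scale[OF assms] real_scaleR_def)
  finally show ?thesis .
qed

theorem lemma2p2:
  fixes M :: "'a measure" and I :: "real set" and P F :: "real \<Rightarrow> 'a measure" and s :: real
    and \<D> :: "(real \<Rightarrow> 'a \<Rightarrow> real) \<Rightarrow> (real \<Rightarrow> 'a \<Rightarrow> complex)"
    and A B :: "real \<times> real \<Rightarrow> real"
  assumes setting: "nelson_setting M I P F"
    and s: "s \<in> {1, -1}"
    and gluing: "\<And>X f f'. \<lbrakk>X \<in> C1 M I P F s; deterministic M I X f;
          \<And>t. t \<in> I \<Longrightarrow> (f has_real_derivative f' t) (at t); continuous_on I f'\<rbrakk>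
        \<Longrightarrow> \<forall>t\<in>I. AE \<omega> in M. \<D> X t \<omega> = complex_of_real (f' t)"
    and real_linear: "\<And>X Y a b. \<lbrakk>X \<in> C1 M I P F s; Y \<in> C1 M I P F s;
          (\<lambda>t \<omega>. a * X t \<omega> + b * Y t \<omega>) \<in> C1 M I P F s\<rbrakk>
        \<Longrightarrow> \<forall>t\<in>I. AE \<omega> in M. \<D> (\<lambda>t \<omega>. a * X t \<omega> + b * Y t \<omega>) t \<omega>
              = complex_of_real a * \<D> X t \<omega> + complex_of_real b * \<D> Y t \<omega>"
    and linear_A: "linear A" and linear_B: "linear B"
    and reconstruction: "\<And>X. X \<in> C1 M I P F s
        \<Longrightarrow> \<forall>t\<in>I. AE \<omega> in M. \<D> X t \<omega> =
              complex_of_real (A (forward_derivative M P X t \<omega>, backward_derivative M F X t \<omega>))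
            + \<i> * complex_of_real (B (forward_derivative M P X t \<omega>, backward_derivative M F X t \<omega>))"
    and invertible: "bij (\<lambda>p. (A p, B p))"
    and antisymmetric: "\<And>d d'. d' = - d \<Longrightarrow> A (d, d') = 0 \<and> B (d, d') = d"
  shows "\<exists>\<mu>\<in>{1, -1 :: real}. \<forall>X\<in>C1 M I P F s. \<forall>t\<in>I. AE \<omega> in M. \<D> X t \<omega> =
              complex_of_real ((forward_derivative M P X t \<omega> + backward_derivative M F X t \<omega>) / 2)
            + \<i> * complex_of_real \<mu> *
              complex_of_real ((forward_derivative M P X t \<omega> - backward_derivative M F X t \<omega>) / 2)"
proof (cases "I = {}")
  case True
  then show ?thesis
    by auto
next
  case False
  then obtain t where t: "t \<in> I"
    by blast
  interpret nelson_setting M I P F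
    by (rule setting)
  have der: "((\<lambda>t. t) has_real_derivative 1) (at u)" for u :: real
    by simp
  have clock: "(\<lambda>t _. t) \<in> C1 M I P F s"
    by (rule deterministic_in_C1[where f' = "\<lambda>_. 1"]) (use s in auto)
  have "AE \<omega> in M. \<D> (\<lambda>t _. t) t \<omega> = complex_of_real 1"
    using gluing[OF clock, of "\<lambda>t. t" "\<lambda>_. 1"] t by (auto simp: deterministic_def)
  moreover have "AE \<omega> in M. \<D> (\<lambda>t _. t) t \<omega> =
      complex_of_real (A (forward_derivative M P (\<lambda>t _. t) t \<omega>, backward_derivative M F (\<lambda>t _. t) t \<omega>))
      + \<i> * complex_of_real
          (B (forward_derivative M P (\<lambda>t _. t) t \<omega>, backward_derivative M F (\<lambda>t _. t) t \<omega>))"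
    using reconstruction[OF clock] t by blast
  moreover note forward_derivative_deterministic(2)[of P t "\<lambda>t. t", OF subalgebra_P[OF t] der]
    backward_derivative_deterministic(2)[of F t "\<lambda>t. t", OF subalgebra_F[OF t] der]
  ultimately have "AE \<omega> in M. 1 = complex_of_real (A (1, 1)) + \<i> * complex_of_real (B (1, 1))"
    by eventually_elim simp
  \<comment> \<open>a constant statement that holds almost surely is true, since the whole space has measure 1\<close>
  then have "1 = complex_of_real (A (1, 1)) + \<i> * complex_of_real (B (1, 1))"
    by simp
  then have diagonal: "A (1, 1) = 1" "B (1, 1) = 0"
    by (simp_all add: complex_eq_iff)
  have "A (1, -1) = 0" "B (1, -1) = 1"
    using antisymmetric[of "-1" 1] by simp_all
  with diagonal have AB: "A (x, y) = (x + y) / 2" "B (x, y) = (x - y) / 2" for x y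
    by (simp_all add: linear_plane_decomposition[OF linear_A, of x y]
        linear_plane_decomposition[OF linear_B, of x y])
  show ?thesis
    using reconstruction by (intro bexI[of _ 1]) (simp_all add: AB)
qed

end
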